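(* Let $G$ be a finite group and let $S\subseteq G$ be a subset with $1\notin S$ that is both Eulerian (for every $s\in S$, every $x\in G$ with $\langle x\rangle=\langle s\rangle$ belongs to $S$; equivalently, $s^k\in S$ for every $s\in S$ and every $k\in\mathbb{Z}$ with $\gcd(k,|s|)=1$) and normal ($g^{-1}sg\in S$ for all $s\in S$, $g\in G$). Then the Cayley graph $\mathrm{Cay}(G,S)$ is integral, i.e. every eigenvalue of its adjacency matrix is an integer.
   Context: All groups and graphs are finite. For a group $G$ and a subset $S\subseteq G$ with $1\notin S$ and $S=S^{-1}$, where $S^{-1}=\{s^{-1}\mid s\in S\}$, the Cayley graph $\mathrm{Cay}(G,S)$ is the undirected loopless graph with vertex set $G$ and edge set $\{(g,gs)\mid g\in G,\ s\in S\}$. Its adjacency matrix is the complex matrix $(a_{g,h})$ with rows and columns indexed by $G$, where $a_{g,h}=1$ if $(g,h)$ is an edge and $a_{g,h}=0$ otherwise. Here $|s|$ denotes the order of the element $s$. Every Eulerian set is automatically symmetric ($S=S^{-1}$), since $\langle s\rangle=\langle s^{-1}\rangle$. *)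

theory Defs
  imports
    "HOL-Algebra.Algebra"
    "Jordan_Normal_Form.Char_Poly"
    "Graph_Theory.Pair_Digraph"
begin

definition eulerian_set :: "('a, 'm) monoid_scheme \<Rightarrow> 'a set \<Rightarrow> bool" where
  "eulerian_set G S \<longleftrightarrow>
     (\<forall>s\<in>S. \<forall>x\<in>carrier G. generate G {x} = generate G {s} \<longrightarrow> x \<in> S)"

definition normal_set :: "('a, 'm) monoid_scheme \<Rightarrow> 'a set \<Rightarrow> bool" where
  "normal_set G S \<longleftrightarrow>
     (\<forall>s\<in>S. \<forall>g\<in>carrier G. inv\<^bsub>G\<^esub> g \<otimes>\<^bsub>G\<^esub> s \<otimes>\<^bsub>G\<^esub> g \<in> S)"

text \<open>As in \<^theory>\<open>Graph_Theory.Pair_Digraph\<close>, an undirected graph is a symmetric digraph: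
  an undirected edge is represented by its two orientations.\<close>

definition cayley_graph :: "('a, 'm) monoid_scheme \<Rightarrow> 'a set \<Rightarrow> 'a pair_pre_digraph" where
  "cayley_graph G S =
     \<lparr> pverts = carrier G, parcs = {(g, g \<otimes>\<^bsub>G\<^esub> s) | g s. g \<in> carrier G \<and> s \<in> S} \<rparr>"

text \<open>Matrices of \<^theory>\<open>Jordan_Normal_Form.Matrix\<close> are indexed by natural numbers, so the
  adjacency matrix depends on an enumeration \<open>vs\<close> of the vertices.\<close>

definition adjacency_matrix :: "'a pair_pre_digraph \<Rightarrow> 'a list \<Rightarrow> complex mat" where
  "adjacency_matrix \<Gamma> vs =
     mat (length vs) (length vs) (\<lambda>(i, j). if (vs ! i, vs ! j) \<in> parcs \<Gamma> then 1 else 0)"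

text \<open>Different enumerations give matrices that are conjugate by a permutation, so quantifying over
  all of them is harmless. An infinite graph has no enumeration and would
  be integral vacuously, so this is only to be used for finite graphs.\<close>

definition integral_graph :: "'a pair_pre_digraph \<Rightarrow> bool" where
  "integral_graph \<Gamma> \<longleftrightarrow>
     (\<forall>vs k. distinct vs \<and> set vs = pverts \<Gamma> \<and> eigenvalue (adjacency_matrix \<Gamma> vs) k
        \<longrightarrow> k \<in> \<int>)"

lemma (in group) eulerian_set_inv:
  assumes "S \<subseteq> carrier G" "eulerian_set G S" "s \<in> S"
  shows "inv s \<in> S"
proof -
  have s: "s \<in> carrier G" using assms by auto
  have sub: "generate G {inv x} \<subseteq> generate G {x}" if "x \<in> carrier G" for x
    using that by (intro generate_subgroup_incl generate_is_subgroup) (auto intro: generate.inv)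
  have "generate G {inv s} = generate G {s}"
    using sub[OF s] sub[of "inv s"] s by auto
  then show ?thesis using assms s unfolding eulerian_set_def by auto
qed

text \<open>In the situation considered, the Cayley graph is a finite undirected loopless graph.\<close>

lemma (in group) pair_graph_cayley_graph:
  assumes "finite (carrier G)" "S \<subseteq> carrier G" "\<one> \<notin> S" "\<And>s. s \<in> S \<Longrightarrow> inv s \<in> S"
  shows "pair_graph (cayley_graph G S)"
proof
  show "finite (pverts (cayley_graph G S))" using assms by (simp add: cayley_graph_def)
  have "parcs (cayley_graph G S) \<subseteq> carrier G \<times> carrier G"
    using assms by (auto simp: cayley_graph_def)
  then show "finite (parcs (cayley_graph G S))"
    by (rule finite_subset) (use assms in simp)
next
  fix e assume e: "e \<in> parcs (cayley_graph G S)"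
  then obtain g s where gs: "e = (g, g \<otimes> s)" "g \<in> carrier G" "s \<in> S" "s \<in> carrier G"
    using assms by (auto simp: cayley_graph_def)
  then show "fst e \<in> pverts (cayley_graph G S)" "snd e \<in> pverts (cayley_graph G S)"
    by (auto simp: cayley_graph_def)
  show "fst e \<noteq> snd e" using gs assms(3) r_cancel_one'[of g s] by auto
next
  show "symmetric (with_proj (cayley_graph G S))"
    unfolding symmetric_def
  proof (rule symI)
    fix u v assume "(u, v) \<in> arcs_ends (with_proj (cayley_graph G S))"
    then obtain s where s: "u \<in> carrier G" "s \<in> S" "v = u \<otimes> s"
      by (auto simp: arcs_ends_def arc_to_ends_def with_proj_def cayley_graph_def)
    have sc: "s \<in> carrier G" using s assms by auto
    have "u = v \<otimes> inv s" using s sc by (simp add: m_assoc)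
    then have "(v, u) \<in> parcs (cayley_graph G S)"
      using s sc assms(4) by (auto simp: cayley_graph_def)
    then show "(v, u) \<in> arcs_ends (with_proj (cayley_graph G S))"
      by (auto simp: arcs_ends_def arc_to_ends_def with_proj_def image_iff)
  qed
qed

end

(*
  Let W be the eigenspace of k, viewed as a space of functions w on G with
  sum_{s in S} w(xs) = k w(x). As S is normal, W is invariant under the right translations
  (rho_g w)(x) = w(xg), and k dim W = sum_{s in S} tr(rho_s | W). For a subgroup H the average of
  the rho_h over H is idempotent, so sum_{h in H} tr(rho_h) = |H| tr(average) is an integer. By
  induction on the order of a cyclic group C, the same holds for the sum over the generators of C
  only, and an Eulerian set is a disjoint union of such sets of generators. Hence k dim W is an
  integer and k is rational; as an eigenvalue of an integer matrix it is an algebraic integer.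
*)
theory Submission
  imports Defs "HOL-Library.Function_Algebras"
begin

section \<open>Linear algebra in spaces of functions\<close>

definition fun_scale :: "'f::field \<Rightarrow> ('i \<Rightarrow> 'f) \<Rightarrow> 'i \<Rightarrow> 'f" where
  "fun_scale c f = (\<lambda>x. c * f x)"

interpretation fun_space: vector_space fun_scale
  by unfold_locales (auto simp: fun_scale_def fun_eq_iff algebra_simps)

lemma sum_fun_apply: "(\<Sum>i\<in>I. f i) x = (\<Sum>i\<in>I. f i x)"
  for f :: "'i \<Rightarrow> 'j \<Rightarrow> 'f::comm_monoid_add"
  by (induction I rule: infinite_finite_induct) auto

lemma representation_lincomb:
  assumes "fun_space.independent B" "\<And>i. i \<in> I \<Longrightarrow> v i \<in> fun_space.span B"
  shows "fun_space.representation B (\<Sum>i\<in>I. fun_scale (c i) (v i)) b =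
    (\<Sum>i\<in>I. c i * fun_space.representation B (v i) b)"
  using assms
  by (subst fun_space.representation_sum)
     (auto simp: fun_space.representation_scale fun_space.span_scale)

text \<open>An idempotent matrix factors through a basis \<open>B\<close> of its column space, and swapping the two
  factors turns it into the identity on \<open>B\<close>.\<close>

lemma trace_idempotent_Ints:
  fixes e :: "'i \<Rightarrow> 'i \<Rightarrow> complex"
  assumes fin: "finite I"
    and idem: "\<And>x y. x \<in> I \<Longrightarrow> y \<in> I \<Longrightarrow> (\<Sum>z\<in>I. e x z * e z y) = e x y"
  shows "(\<Sum>x\<in>I. e x x) \<in> \<int>"
proof -
  \<comment> \<open>Extending columns by zero off \<open>I\<close> makes equality of functions the
    same as equality on \<open>I\<close>.\<close>
  define col where "col y = (\<lambda>x. if x \<in> I then e x y else 0)" for y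
  obtain B where B: "B \<subseteq> col ` I" "fun_space.independent B" "col ` I \<subseteq> fun_space.span B"
    by (rule fun_space.maximal_independent_subset)
  have finB: "finite B" using B(1) fin by (meson finite_imageI finite_subset)
  define r where "r = fun_space.representation B"
  \<comment> \<open>The left-hand side is the matrix \<open>e\<close> applied to \<open>b\<close>;
    idempotence says that \<open>e\<close> fixes each of its own columns.\<close>
  have fixed: "(\<Sum>y\<in>I. fun_scale (b y) (col y)) = b" if "b \<in> B" for b
  proof -
    obtain y' where y': "y' \<in> I" "b = col y'" using B(1) \<open>b \<in> B\<close> by auto
    show ?thesis
      unfolding y'
      by (rule ext) (use idem y' in \<open>auto simp: sum_fun_apply fun_scale_def col_def mult.commute\<close>)
  qed
  \<comment> \<open>This compares the coordinates at \<open>b\<close> of both sides of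
    \<open>fixed\<close>: a diagonal entry of the swapped product.\<close>
  have diag: "(\<Sum>y\<in>I. b y * r (col y) b) = 1" if "b \<in> B" for b
  proof -
    have "(\<Sum>y\<in>I. b y * r (col y) b) = r (\<Sum>y\<in>I. fun_scale (b y) (col y)) b"
      unfolding r_def using B by (subst representation_lincomb) auto
    also have "\<dots> = 1"
      unfolding fixed[OF that] r_def using B that by (simp add: fun_space.representation_basis)
    finally show ?thesis .
  qed
  have "(\<Sum>x\<in>I. e x x) = (\<Sum>x\<in>I. \<Sum>b\<in>B. b x * r (col x) b)"
  proof (rule sum.cong)
    fix x assume x: "x \<in> I"
    have "col x = (\<Sum>b\<in>B. fun_scale (r (col x) b) b)"
      unfolding r_def using B x finB
      by (subst fun_space.sum_representation_eq) auto
    then have "col x x = (\<Sum>b\<in>B. fun_scale (r (col x) b) b) x" by simp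
    then show "e x x = (\<Sum>b\<in>B. b x * r (col x) b)"
      using x by (simp add: col_def sum_fun_apply fun_scale_def mult.commute)
  qed simp
  also have "\<dots> = (\<Sum>b\<in>B. \<Sum>x\<in>I. b x * r (col x) b)" by (rule sum.swap)
  also have "\<dots> = of_nat (card B)" by (simp add: diag)
  finally show ?thesis by simp
qed

section \<open>Integrality of sums over Eulerian sets\<close>

context group
begin

text \<open>Grouping the elements of the cyclic group \<open>H\<close> by the subgroup they generate
  splits \<open>sum t H\<close> into the wanted sum over the generators of \<open>H\<close> and sums
  over the generators of smaller cyclic groups. The latter are integers by induction, and so is
  \<open>sum t H\<close>.\<close>

lemma sum_generators_Ints:
  fixes t :: "'a \<Rightarrow> complex"
  assumes fin: "finite (carrier G)"
    and sub: "\<And>H. subgroup H G \<Longrightarrow> sum t H \<in> \<int>"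
    and "s \<in> carrier G"
  shows "sum t {x \<in> carrier G. generate G {x} = generate G {s}} \<in> \<int>"
  using \<open>s \<in> carrier G\<close>
proof (induction "card (generate G {s})" arbitrary: s rule: less_induct)
  case less
  define H where "H = generate G {s}"
  have H: "subgroup H G" unfolding H_def using less.prems by (simp add: generate_is_subgroup)
  have HG: "H \<subseteq> carrier G" using H by (rule subgroup.subset)
  have finH: "finite H" using HG fin by (rule finite_subset)
  have genH: "generate G {x} \<subseteq> H" if "x \<in> H" for x
    using that H by (simp add: generate_subgroup_incl)
  have self: "x \<in> generate G {x}" for x by (simp add: generate.incl)
  \<comment> \<open>Any generator of a subgroup of \<open>H\<close> already lies in
    \<open>H\<close>, so the classes inside \<open>H\<close> are complete.\<close>
  have part: "{x \<in> H. generate G {x} = generate G {y}} =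
      {x \<in> carrier G. generate G {x} = generate G {y}}" if "y \<in> H" for y
    using genH[OF that] self HG by (metis (no_types, lifting) subset_iff Collect_cong)
  define gens where "gens D = sum t {x \<in> carrier G. generate G {x} = D}" for D
  have "sum t H = (\<Sum>D\<in>(\<lambda>x. generate G {x}) ` H. sum t {x \<in> H. generate G {x} = D})"
    by (rule sum.image_gen[OF finH])
  also have "\<dots> = (\<Sum>D\<in>(\<lambda>x. generate G {x}) ` H. gens D)"
    unfolding gens_def using part by (intro sum.cong) (auto cong: conj_cong)
  also have "\<dots> = gens H + (\<Sum>D\<in>(\<lambda>x. generate G {x}) ` H - {H}. gens D)"
    using finH self[of s] unfolding H_def by (subst sum.remove) auto
  finally have "gens H = sum t H - (\<Sum>D\<in>(\<lambda>x. generate G {x}) ` H - {H}. gens D)" by simp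
  moreover have "gens D \<in> \<int>" if D: "D \<in> (\<lambda>x. generate G {x}) ` H - {H}" for D
  proof -
    obtain x where x: "x \<in> H" "D = generate G {x}" "D \<noteq> H" using D by auto
    have "card D < card H" using genH[OF x(1)] x finH by (auto intro: psubset_card_mono)
    then show ?thesis
      using less.hyps[of x] x HG unfolding gens_def H_def by auto
  qed
  ultimately have "gens H \<in> \<int>" using sub[OF H] by (auto intro!: Ints_diff Ints_sum)
  then show ?case unfolding gens_def H_def .
qed

text \<open>By the Eulerian property, each fibre of the map from \<open>x\<close> to
  \<open>generate G {x}\<close> on \<open>S\<close> is the full set of generators of a cyclic
  subgroup.\<close>

lemma sum_eulerian_Ints:
  fixes t :: "'a \<Rightarrow> complex"
  assumes fin: "finite (carrier G)"
    and sub: "\<And>H. subgroup H G \<Longrightarrow> sum t H \<in> \<int>"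
    and S: "S \<subseteq> carrier G" "eulerian_set G S"
  shows "sum t S \<in> \<int>"
proof -
  have "sum t S = (\<Sum>D\<in>(\<lambda>x. generate G {x}) ` S. sum t {x \<in> S. generate G {x} = D})"
    using S fin by (intro sum.image_gen) (auto intro: finite_subset)
  also have "\<dots> \<in> \<int>"
  proof (rule Ints_sum)
    fix D assume "D \<in> (\<lambda>x. generate G {x}) ` S"
    then obtain s where s: "s \<in> S" "D = generate G {s}" by auto
    have "{x \<in> S. generate G {x} = D} = {x \<in> carrier G. generate G {x} = generate G {s}}"
      using S s unfolding eulerian_set_def by auto
    then show "sum t {x \<in> S. generate G {x} = D} \<in> \<int>"
      using sum_generators_Ints[OF fin sub, of s] s S by auto
  qed
  finally show ?thesis .
qed

section \<open>The eigenspace as a representation of the group\<close>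

text \<open>Functions here are total on the type \<open>'a\<close>; vanishing off the carrier makes
  them stand for functions on the group.\<close>

definition cayley_eigenspace :: "'a set \<Rightarrow> complex \<Rightarrow> ('a \<Rightarrow> complex) set" where
  "cayley_eigenspace S k = {w. (\<forall>x. x \<notin> carrier G \<longrightarrow> w x = 0) \<and>
     (\<forall>x\<in>carrier G. (\<Sum>s\<in>S. w (x \<otimes> s)) = k * w x)}"

definition rtranslate :: "'a \<Rightarrow> ('a \<Rightarrow> complex) \<Rightarrow> 'a \<Rightarrow> complex" where
  "rtranslate g w = (\<lambda>x. if x \<in> carrier G then w (x \<otimes> g) else 0)"

lemma rtranslate_mult:
  assumes "g \<in> carrier G" "h \<in> carrier G"
  shows "rtranslate (g \<otimes> h) w = rtranslate g (rtranslate h w)"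
  using assms by (auto simp: rtranslate_def fun_eq_iff m_assoc)

lemma rtranslate_lincomb:
  "rtranslate g (\<Sum>i\<in>I. fun_scale (c i) (v i)) = (\<Sum>i\<in>I. fun_scale (c i) (rtranslate g (v i)))"
  by (auto simp: rtranslate_def fun_eq_iff sum_fun_apply fun_scale_def)

text \<open>Conjugation by \<open>g\<close> permutes \<open>S\<close>, and
  \<open>s \<otimes> g\<close> equals \<open>g\<close> times the conjugate of
  \<open>s\<close>.\<close>

lemma sum_normal_set_commute:
  fixes f :: "'a \<Rightarrow> complex"
  assumes fin: "finite (carrier G)" and S: "S \<subseteq> carrier G" "normal_set G S"
    and g: "g \<in> carrier G"
  shows "(\<Sum>s\<in>S. f (s \<otimes> g)) = (\<Sum>s\<in>S. f (g \<otimes> s))"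
proof -
  define c where "c s = inv g \<otimes> s \<otimes> g" for s
  have inj: "inj_on c S"
    using S g unfolding c_def inj_on_def by (auto simp: subset_iff)
  moreover have "c ` S \<subseteq> S" using S g unfolding c_def normal_set_def by auto
  moreover have "finite S" using S fin by (auto intro: finite_subset)
  ultimately have bij: "bij_betw c S S" by (simp add: bij_betw_def endo_inj_surj)
  have "g \<otimes> c s = s \<otimes> g" if "s \<in> S" for s
  proof -
    have "s \<in> carrier G" using that S by auto
    then show ?thesis unfolding c_def using g by (simp add: m_assoc[symmetric])
  qed
  then show ?thesis
    by (subst sum.reindex_bij_betw[OF bij, symmetric]) simp
qed

text \<open>Normality lets \<open>g\<close> move past \<open>s\<close> under the sum, so summing
  over \<open>S\<close> commutes with right translation.\<close>

lemma rtranslate_cayley_eigenspace: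
  assumes fin: "finite (carrier G)" and S: "S \<subseteq> carrier G" "normal_set G S"
    and g: "g \<in> carrier G" and w: "w \<in> cayley_eigenspace S k"
  shows "rtranslate g w \<in> cayley_eigenspace S k"
proof -
  have "(\<Sum>s\<in>S. rtranslate g w (x \<otimes> s)) = k * rtranslate g w x" if x: "x \<in> carrier G" for x
  proof -
    have "(\<Sum>s\<in>S. rtranslate g w (x \<otimes> s)) = (\<Sum>s\<in>S. w (x \<otimes> (s \<otimes> g)))"
      using S x g by (intro sum.cong) (auto simp: rtranslate_def m_assoc subset_iff)
    also have "\<dots> = (\<Sum>s\<in>S. w (x \<otimes> (g \<otimes> s)))"
      by (rule sum_normal_set_commute[OF fin S g])
    also have "\<dots> = (\<Sum>s\<in>S. w ((x \<otimes> g) \<otimes> s))"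
      using S x g by (intro sum.cong) (auto simp: m_assoc subset_iff)
    also have "\<dots> = k * w (x \<otimes> g)"
      using w x g by (simp add: cayley_eigenspace_def)
    finally show ?thesis using x by (simp add: rtranslate_def)
  qed
  then show ?thesis by (simp add: cayley_eigenspace_def rtranslate_def)
qed

text \<open>The eigenspace lies in the span of the point indicators \<open>\<delta> y\<close> for
  \<open>y\<close> in the finite carrier, which bounds the size of \<open>B\<close>.\<close>

lemma cayley_eigenspace_finite_independent:
  assumes fin: "finite (carrier G)" and B: "B \<subseteq> cayley_eigenspace S k" "fun_space.independent B"
  shows "finite B"
proof -
  define \<delta> :: "'a \<Rightarrow> 'a \<Rightarrow> complex" where "\<delta> y = (\<lambda>x. if x = y then 1 else 0)" for y
  have "w \<in> fun_space.span (\<delta> ` carrier G)" if "w \<in> B" for w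
  proof -
    have "w = (\<Sum>y\<in>carrier G. fun_scale (w y) (\<delta> y))"
    proof
      fix x
      have "w x = (\<Sum>y\<in>carrier G. if x = y then w y else 0)"
        using B(1) that fin by (auto simp: cayley_eigenspace_def)
      also have "\<dots> = (\<Sum>y\<in>carrier G. fun_scale (w y) (\<delta> y)) x"
        unfolding sum_fun_apply fun_scale_def \<delta>_def by (intro sum.cong) auto
      finally show "w x = (\<Sum>y\<in>carrier G. fun_scale (w y) (\<delta> y)) x" .
    qed
    also have "\<dots> \<in> fun_space.span (\<delta> ` carrier G)"
      by (intro fun_space.span_sum fun_space.span_scale fun_space.span_base) auto
    finally show ?thesis .
  qed
  then show ?thesis
    using fun_space.independent_span_bound[of "\<delta> ` carrier G" B] B fin by auto
qed

text \<open>The character \<open>t\<close> of the eigenspace is summed over \<open>S\<close> in two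
  ways: the sum is an integer because \<open>S\<close> is Eulerian, and it equals
  \<open>card B\<close> times \<open>k\<close> by the eigenvalue equation.\<close>

lemma cayley_eigenvalue_Rats:
  assumes fin: "finite (carrier G)" and S: "S \<subseteq> carrier G" "eulerian_set G S" "normal_set G S"
    and w: "w \<in> cayley_eigenspace S k" "w \<noteq> 0"
  shows "k \<in> \<rat>"
proof -
  let ?W = "cayley_eigenspace S k"
  obtain B where B: "B \<subseteq> ?W" "fun_space.independent B" "?W \<subseteq> fun_space.span B"
    by (rule fun_space.maximal_independent_subset)
  have finB: "finite B" by (rule cayley_eigenspace_finite_independent[OF fin B(1,2)])
  have neB: "B \<noteq> {}" using w B(3) by auto
  define r where "r = fun_space.representation B"
  \<comment> \<open>The matrix of translation by \<open>g\<close> in the basis \<open>B\<close>,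
    with row index \<open>b'\<close> and column index \<open>b\<close>.\<close>
  define \<rho> where "\<rho> g b' b = r (rtranslate g b) b'" for g b' b
  define t where "t g = (\<Sum>b\<in>B. \<rho> g b b)" for g
  have trW: "rtranslate g b \<in> ?W" if "g \<in> carrier G" "b \<in> B" for g b
    using rtranslate_cayley_eigenspace[OF fin S(1,3)] that B(1) by auto
  have \<rho>_mult: "(\<Sum>b'\<in>B. \<rho> g b'' b' * \<rho> h b' b) = \<rho> (g \<otimes> h) b'' b"
    if gh: "g \<in> carrier G" "h \<in> carrier G" and b: "b \<in> B" for g h b b''
  proof -
    have "rtranslate h b = (\<Sum>b'\<in>B. fun_scale (\<rho> h b' b) b')"
      unfolding \<rho>_def r_def using B trW[OF gh(2) b] finB
      by (subst fun_space.sum_representation_eq) auto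
    then have "rtranslate (g \<otimes> h) b = (\<Sum>b'\<in>B. fun_scale (\<rho> h b' b) (rtranslate g b'))"
      by (simp add: rtranslate_mult gh rtranslate_lincomb)
    then have "\<rho> (g \<otimes> h) b'' b = (\<Sum>b'\<in>B. \<rho> h b' b * r (rtranslate g b') b'')"
      unfolding r_def \<rho>_def[of "g \<otimes> h"] using B trW[OF gh(1)] by (simp add: representation_lincomb subset_iff)
    then show ?thesis by (simp add: \<rho>_def mult.commute)
  qed
  have "sum t H \<in> \<int>" if H: "subgroup H G" for H
  proof -
    have HG: "H \<subseteq> carrier G" using H by (rule subgroup.subset)
    have finH: "finite H" using HG fin by (rule finite_subset)
    have cH: "card H \<noteq> 0" using finH subgroup.one_closed[OF H] by auto
    \<comment> \<open>The matrix of the projection onto the \<open>H\<close>-invariant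
      vectors.\<close>
    define e where "e b' b = (\<Sum>h\<in>H. \<rho> h b' b) / of_nat (card H)" for b' b
    \<comment> \<open>Left multiplication by \<open>g\<close> permutes \<open>H\<close>, so the
      average absorbs every \<rho>-factor from \<open>H\<close>.\<close>
    have shift: "(\<Sum>h\<in>H. f (g \<otimes> h)) = sum f H" if g: "g \<in> H" for f :: "'a \<Rightarrow> complex" and g
    proof -
      have "inj_on ((\<otimes>) g) H" using g HG by (auto simp: inj_on_def subset_iff)
      moreover have "(\<otimes>) g ` H \<subseteq> H" using g H by (auto simp: subgroup.m_closed)
      ultimately have "bij_betw ((\<otimes>) g) H H" using finH by (simp add: bij_betw_def endo_inj_surj)
      from sum.reindex_bij_betw[OF this] show ?thesis .
    qed
    have idem: "(\<Sum>b'\<in>B. e b'' b' * e b' b) = e b'' b" if b: "b \<in> B" for b'' b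
    proof -
      have "(\<Sum>b'\<in>B. (\<Sum>g\<in>H. \<rho> g b'' b') * (\<Sum>h\<in>H. \<rho> h b' b)) =
          (\<Sum>b'\<in>B. \<Sum>g\<in>H. \<Sum>h\<in>H. \<rho> g b'' b' * \<rho> h b' b)"
        by (simp add: sum_product)
      also have "\<dots> = (\<Sum>g\<in>H. \<Sum>b'\<in>B. \<Sum>h\<in>H. \<rho> g b'' b' * \<rho> h b' b)" by (rule sum.swap)
      also have "\<dots> = (\<Sum>g\<in>H. \<Sum>h\<in>H. \<Sum>b'\<in>B. \<rho> g b'' b' * \<rho> h b' b)"
        by (intro sum.cong refl sum.swap)
      also have "\<dots> = (\<Sum>g\<in>H. \<Sum>h\<in>H. \<rho> (g \<otimes> h) b'' b)"
        using HG b by (intro sum.cong refl \<rho>_mult) auto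
      also have "\<dots> = (\<Sum>g\<in>H. \<Sum>h\<in>H. \<rho> h b'' b)"
        by (intro sum.cong refl shift)
      also have "\<dots> = of_nat (card H) * (\<Sum>h\<in>H. \<rho> h b'' b)" by simp
      finally show ?thesis
        using cH by (simp add: e_def sum_divide_distrib[symmetric])
    qed
    have "sum t H = (\<Sum>b\<in>B. \<Sum>h\<in>H. \<rho> h b b)" unfolding t_def by (rule sum.swap)
    also have "\<dots> = of_nat (card H) * (\<Sum>b\<in>B. e b b)"
      using cH by (simp add: e_def sum_divide_distrib[symmetric])
    also have "\<dots> \<in> \<int>" using trace_idempotent_Ints[OF finB idem] by auto
    finally show ?thesis .
  qed
  then have int: "sum t S \<in> \<int>" by (rule sum_eulerian_Ints[OF fin _ S(1,2)])
  have "sum t S = (\<Sum>b\<in>B. \<Sum>s\<in>S. \<rho> s b b)" unfolding t_def by (rule sum.swap)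
  also have "\<dots> = (\<Sum>b\<in>B. k)"
  proof (rule sum.cong)
    fix b assume b: "b \<in> B"
    then have bW: "b \<in> ?W" using B by auto
    \<comment> \<open>This is the eigenvalue equation for \<open>b\<close>, read as an identity
      between translates. The factor 1 fits it to \<open>representation_lincomb\<close>.\<close>
    have "(\<Sum>s\<in>S. fun_scale 1 (rtranslate s b)) = fun_scale k b"
    proof
      fix x
      show "(\<Sum>s\<in>S. fun_scale 1 (rtranslate s b)) x = fun_scale k b x"
        using bW by (cases "x \<in> carrier G")
          (auto simp: sum_fun_apply fun_scale_def rtranslate_def cayley_eigenspace_def)
    qed
    then have "(\<Sum>s\<in>S. 1 * \<rho> s b b) = r (fun_scale k b) b"
      unfolding \<rho>_def r_def using B S trW[OF _ b] by (subst representation_lincomb[symmetric]) auto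
    also have "\<dots> = k"
      unfolding r_def using B b
      by (simp add: fun_space.representation_scale fun_space.representation_basis fun_space.span_base)
    finally show "(\<Sum>s\<in>S. \<rho> s b b) = k" by simp
  qed simp
  finally have "sum t S = of_nat (card B) * k" by simp
  moreover have "card B \<noteq> 0" using finB neB by simp
  ultimately have "k = sum t S / of_nat (card B)" by simp
  then show ?thesis using int by (auto elim!: Ints_cases)
qed

section \<open>From the adjacency matrix to functions on the group\<close>

lemma eigenvector_cayley_eigenspace:
  assumes S: "S \<subseteq> carrier G" and vs: "distinct vs" "set vs = carrier G"
    and ev: "eigenvalue (adjacency_matrix (cayley_graph G S) vs) k"
  obtains w where "w \<in> cayley_eigenspace S k" "w \<noteq> 0"
proof -
  let ?A = "adjacency_matrix (cayley_graph G S) vs"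
  let ?n = "length vs"
  obtain v where v: "v \<in> carrier_vec ?n" "v \<noteq> 0\<^sub>v ?n" "?A *\<^sub>v v = k \<cdot>\<^sub>v v"
    using ev by (auto simp: eigenvalue_def eigenvector_def adjacency_matrix_def)
  have bij: "bij_betw ((!) vs) {..<?n} (carrier G)" using vs by (simp add: bij_betw_nth)
  \<comment> \<open>The position of a group element in the enumeration \<open>vs\<close>, used to
    read the vector \<open>v\<close> as a function on the group.\<close>
  define idx where "idx = the_inv_into {..<?n} ((!) vs)"
  have idx: "idx (vs ! i) = i" if "i < ?n" for i
    unfolding idx_def using that bij by (auto simp: bij_betw_def the_inv_into_f_f)
  define w where "w x = (if x \<in> carrier G then v $ idx x else 0)" for x
  have w: "w (vs ! i) = v $ i" if "i < ?n" for i
    using that vs idx by (auto simp: w_def)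
  have finS: "finite S" using S vs by (metis finite_set finite_subset)
  have "(\<Sum>s\<in>S. w (x \<otimes> s)) = k * w x" if x: "x \<in> carrier G" for x
  proof -
    obtain i where i: "i < ?n" "x = vs ! i" using x vs by (metis in_set_conv_nth)
    \<comment> \<open>Distinct elements of \<open>S\<close> lead from \<open>x\<close> to distinct
      neighbours, so the sum over \<open>S\<close> is a sum over neighbours, weighted by the 0/1
      entries of row \<open>i\<close>.\<close>
    have inj: "inj_on ((\<otimes>) x) S" using x S by (auto simp: inj_on_def subset_iff)
    have sub: "(\<otimes>) x ` S \<subseteq> carrier G" using x S by auto
    have arc: "(x, y) \<in> parcs (cayley_graph G S) \<longleftrightarrow> y \<in> (\<otimes>) x ` S" for y
      using x by (auto simp: cayley_graph_def)
    have "(\<Sum>s\<in>S. w (x \<otimes> s)) = (\<Sum>y\<in>(\<otimes>) x ` S. w y)" by (simp add: sum.reindex[OF inj])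
    also have "\<dots> = (\<Sum>y\<in>carrier G. if y \<in> (\<otimes>) x ` S then w y else 0)"
      using sub vs(2)[symmetric] by (simp add: sum.inter_restrict[symmetric] Int_absorb1)
    also have "\<dots> = (\<Sum>j<?n. if vs ! j \<in> (\<otimes>) x ` S then w (vs ! j) else 0)"
      by (rule sum.reindex_bij_betw[OF bij, symmetric])
    also have "\<dots> = (\<Sum>j<?n. ?A $$ (i, j) * v $ j)"
      using i by (intro sum.cong) (auto simp: adjacency_matrix_def arc[unfolded i(2)] w)
    also have "\<dots> = (?A *\<^sub>v v) $ i"
      using i(1) v(1) unfolding adjacency_matrix_def
      by (simp add: scalar_prod_def lessThan_atLeast0)
    also have "\<dots> = k * w x" using i v by (simp add: w)
    finally show ?thesis .
  qed
  then have "w \<in> cayley_eigenspace S k" by (auto simp: cayley_eigenspace_def w_def)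
  moreover have "w \<noteq> 0"
  proof
    assume "w = 0"
    then have "v $ i = 0" if "i < ?n" for i using w[OF that] by simp
    then have "v = 0\<^sub>v ?n" using v by auto
    then show False using v by simp
  qed
  ultimately show thesis by (rule that)
qed

end

text \<open>The 0/1 entries come from an integer matrix, whose characteristic polynomial is monic
  with integer coefficients and has \<open>k\<close> as a root.\<close>

lemma eigenvalue_adjacency_matrix_algebraic_int:
  assumes "eigenvalue (adjacency_matrix \<Gamma> vs) k"
  shows "algebraic_int k"
proof -
  define A where "A = mat (length vs) (length vs)
    (\<lambda>(i, j). if (vs ! i, vs ! j) \<in> parcs \<Gamma> then 1 else (0::int))"
  have A: "A \<in> carrier_mat (length vs) (length vs)" by (simp add: A_def)
  have eq: "adjacency_matrix \<Gamma> vs = map_mat of_int A"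
    by (auto simp: A_def adjacency_matrix_def)
  have "poly (char_poly (map_mat of_int A :: complex mat)) k = 0"
    using assms A unfolding eq by (subst eigenvalue_root_char_poly[symmetric]) auto
  then have "poly (map_poly of_int (char_poly A)) k = 0"
    by (simp add: of_int_hom.char_poly_hom[OF A])
  then show ?thesis
    using degree_monic_char_poly[OF A] by (auto simp: algebraic_int_altdef_ipoly)
qed

theorem mainTheorem1:
  fixes G :: "('a, 'm) monoid_scheme" and S :: "'a set"
  assumes "group G" and "finite (carrier G)"
    and "S \<subseteq> carrier G" and "\<one>\<^bsub>G\<^esub> \<notin> S"
    and "eulerian_set G S" and "normal_set G S"
  shows "integral_graph (cayley_graph G S)"
proof -
  interpret group G by fact
  show ?thesis
    unfolding integral_graph_def
  proof (intro allI impI, elim conjE)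
    fix vs k
    assume vs: "distinct vs" "set vs = pverts (cayley_graph G S)"
      and ev: "eigenvalue (adjacency_matrix (cayley_graph G S) vs) k"
    obtain w where "w \<in> cayley_eigenspace S k" "w \<noteq> 0"
      using eigenvector_cayley_eigenspace[OF assms(3) vs(1) _ ev] vs(2)
      by (auto simp: cayley_graph_def)
    then have "k \<in> \<rat>" using cayley_eigenvalue_Rats assms by blast
    then show "k \<in> \<int>"
      using eigenvalue_adjacency_matrix_algebraic_int[OF ev]
      by (simp add: rational_algebraic_int_is_int)
  qed
qed

end
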